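(* Let $K:X\to Y$ be a linear, compact and injective operator between infinite-dimensional separable real Hilbert spaces, let $\{\phi_i\}_{i=1}^\infty$ be an orthonormal basis of $X$, and fix an index $j$. Let $\alpha>0$. If for some scalar $\gamma>0$ the element $x=\gamma\phi_j$ is a solution of $$\min_{x\in X}\left\{\frac12\|Kx-K\phi_j\|^2+\alpha\sum_{i}|(x,\phi_i)|\right\},$$ then $$|(K\phi_j,K\phi_l)|\le (K\phi_j,K\phi_j)\quad\text{for all } l.$$ (Equivalently: $x=\gamma\phi_j$ does not solve the minimization problem for any $\gamma>0$ unless this inequality holds for all $l$.)
   Context: $(\cdot,\cdot)$ and $\|\cdot\|$ denote the inner product and norm of $X$ or $Y$, according to context. The sum $\sum_i|(x,\phi_i)|$ runs over all $i=1,2,\ldots$ and is allowed to take the value $+\infty$; "solution" means a global minimizer over $X$. *)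

theory Defs
  imports "HOL-Analysis.Analysis"
begin

definition infinite_dimensional :: "'a::real_vector set \<Rightarrow> bool" where
  "infinite_dimensional V \<longleftrightarrow> \<not> (\<exists>B. finite B \<and> V \<subseteq> span B)"

definition compact_operator :: "('a::real_normed_vector \<Rightarrow> 'b::real_normed_vector) \<Rightarrow> bool" where
  "compact_operator K \<longleftrightarrow> linear K \<and> (\<forall>S. bounded S \<longrightarrow> compact (closure (K ` S)))"

(* A basis enumerated as phi_1, phi_2, ... is indexed here by all of nat, starting at 0. *)
definition orthonormal_basis :: "(nat \<Rightarrow> 'a::real_inner) \<Rightarrow> bool" where
  "orthonormal_basis \<phi> \<longleftrightarrow>
     (\<forall>i k. \<phi> i \<bullet> \<phi> k = (if i = k then 1 else 0)) \<and> closure (span (range \<phi>)) = UNIV"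

(* Extended-real valued, since the series of coefficients in absolute value may diverge. *)
definition l1_functional ::
    "('a::real_inner \<Rightarrow> 'b::real_inner) \<Rightarrow> 'b \<Rightarrow> real \<Rightarrow> (nat \<Rightarrow> 'a) \<Rightarrow> 'a \<Rightarrow> ereal" where
  "l1_functional K y \<alpha> \<phi> x =
     ereal (1 / 2 * (norm (K x - y))\<^sup>2) + ereal \<alpha> * (\<Sum>i. ereal \<bar>x \<bullet> \<phi> i\<bar>)"

end

theory Submission
  imports Defs
begin

text \<open>Moving from \<open>\<gamma> \<phi>\<^sub>j\<close> to \<open>(\<gamma> - \<epsilon>) \<phi>\<^sub>j\<close> shows \<open>\<gamma> < 1\<close>, because the first-order
  change of the objective is \<open>- \<epsilon> ((\<gamma> - 1) \<parallel>K \<phi>\<^sub>j\<parallel>\<^sup>2 + \<alpha>)\<close>. Moving to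
  \<open>(\<gamma> - \<epsilon>) \<phi>\<^sub>j \<plusminus> \<epsilon> \<phi>\<^sub>l\<close> leaves the penalty unchanged, so minimality of the residual gives
  \<open>(\<gamma> - 1) (K \<phi>\<^sub>j, \<plusminus> K \<phi>\<^sub>l - K \<phi>\<^sub>j) \<ge> 0\<close>, and \<open>\<gamma> - 1\<close> is negative.\<close>

text \<open>Dividing by \<open>e\<close> and letting \<open>e\<close> tend to 0 from the right
  removes the quadratic term. This turns minimality along a segment into a first-order
  condition.\<close>

lemma linear_coefficient_nonneg:
  fixes p q c :: real
  assumes "c > 0" and "\<And>e. 0 < e \<Longrightarrow> e \<le> c \<Longrightarrow> 0 \<le> e * p + e\<^sup>2 * q"
  shows "p \<ge> 0"
proof -
  have "((\<lambda>e. p + e * q) \<longlongrightarrow> p + 0 * q) (at_right 0)"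
    by (intro tendsto_intros)
  moreover have "\<forall>\<^sub>F e in at_right 0. 0 \<le> p + e * q"
    unfolding eventually_at_right_field
  proof (intro exI conjI allI impI)
    fix e :: real assume e: "0 < e" "e < c"
    then have "0 \<le> e * (p + e * q)"
      using assms(2)[of e] by (simp add: power2_eq_square algebra_simps)
    with e show "0 \<le> p + e * q"
      by (simp add: zero_le_mult_iff)
  qed (use assms in auto)
  ultimately show ?thesis
    using tendsto_lowerbound[of "\<lambda>e. p + e * q" "p + 0 * q" "at_right 0" 0] by simp
qed

text \<open>By orthonormality only the coefficients at \<open>j\<close> and \<open>l\<close> can be
  nonzero, so the series is a finite sum and minimality becomes an inequality between reals.\<close>

lemma l1_functional_two_terms:
  assumes on: "\<And>i k. \<phi> i \<bullet> \<phi> k = (if i = k then 1 else 0)"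
    and "linear K" and "j \<noteq> l"
  shows "l1_functional K (K (\<phi> j)) \<alpha> \<phi> (s *\<^sub>R \<phi> j + t *\<^sub>R \<phi> l) =
    ereal (1 / 2 * (norm ((s - 1) *\<^sub>R K (\<phi> j) + t *\<^sub>R K (\<phi> l)))\<^sup>2 + \<alpha> * (\<bar>s\<bar> + \<bar>t\<bar>))"
proof -
  have "(\<Sum>i. ereal \<bar>(s *\<^sub>R \<phi> j + t *\<^sub>R \<phi> l) \<bullet> \<phi> i\<bar>)
      = (\<Sum>i\<in>{j, l}. ereal \<bar>(s *\<^sub>R \<phi> j + t *\<^sub>R \<phi> l) \<bullet> \<phi> i\<bar>)"
    by (rule suminf_finite) (auto simp: inner_add_left on zero_ereal_def)
  also have "\<dots> = ereal (\<bar>s\<bar> + \<bar>t\<bar>)"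
    using \<open>j \<noteq> l\<close> by (simp add: inner_add_left on)
  finally have "(\<Sum>i. ereal \<bar>(s *\<^sub>R \<phi> j + t *\<^sub>R \<phi> l) \<bullet> \<phi> i\<bar>) = ereal (\<bar>s\<bar> + \<bar>t\<bar>)" .
  moreover have "K (s *\<^sub>R \<phi> j + t *\<^sub>R \<phi> l) - K (\<phi> j) = (s - 1) *\<^sub>R K (\<phi> j) + t *\<^sub>R K (\<phi> l)"
    using \<open>linear K\<close> by (simp add: linear_add linear_scale algebra_simps)
  ultimately show ?thesis
    by (simp add: l1_functional_def)
qed

theorem proposition3p1:
  fixes K :: "'a::{real_inner, complete_space} \<Rightarrow> 'b::{real_inner, complete_space}"
    and \<phi> :: "nat \<Rightarrow> 'a" and j :: nat and \<alpha> \<gamma> :: real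
  assumes "infinite_dimensional (UNIV :: 'a set)" and "infinite_dimensional (UNIV :: 'b set)"
    and "separable_space (euclidean :: 'a topology)" and "separable_space (euclidean :: 'b topology)"
    and "compact_operator K" and "inj K"
    and "orthonormal_basis \<phi>"
    and "\<alpha> > 0" and "\<gamma> > 0"
    and "is_arg_min (l1_functional K (K (\<phi> j)) \<alpha> \<phi>) (\<lambda>_. True) (\<gamma> *\<^sub>R \<phi> j)"
  shows "\<forall>l. \<bar>K (\<phi> j) \<bullet> K (\<phi> l)\<bar> \<le> K (\<phi> j) \<bullet> K (\<phi> j)"
proof
  fix l
  have lin: "linear K"
    using assms(5) by (simp add: compact_operator_def)
  have on: "\<phi> i \<bullet> \<phi> k = (if i = k then 1 else 0)" for i k
    using assms(7) by (simp add: orthonormal_basis_def)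
  define a where "a = K (\<phi> j)"
  define b where "b = K (\<phi> l)"
  have min: "l1_functional K (K (\<phi> j)) \<alpha> \<phi> (\<gamma> *\<^sub>R \<phi> j) \<le> l1_functional K (K (\<phi> j)) \<alpha> \<phi> x" for x
    using assms(10) by (simp add: is_arg_min_linorder)
  show "\<bar>K (\<phi> j) \<bullet> K (\<phi> l)\<bar> \<le> K (\<phi> j) \<bullet> K (\<phi> j)"
  proof (cases "l = j")
    case False
    \<comment> \<open>The minimizer itself is the two-term point with coefficients
      \<open>\<gamma>\<close> and 0.\<close>
    have le: "1 / 2 * (norm ((\<gamma> - 1) *\<^sub>R a))\<^sup>2 + \<alpha> * \<gamma>
        \<le> 1 / 2 * (norm ((s - 1) *\<^sub>R a + t *\<^sub>R b))\<^sup>2 + \<alpha> * (\<bar>s\<bar> + \<bar>t\<bar>)" for s t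
      using min[of "s *\<^sub>R \<phi> j + t *\<^sub>R \<phi> l"] \<open>\<gamma> > 0\<close>
        l1_functional_two_terms[OF on lin False[symmetric], of \<alpha> \<gamma> 0]
        l1_functional_two_terms[OF on lin False[symmetric], of \<alpha> s t]
      by (simp add: a_def b_def)
    have "0 \<le> - ((\<gamma> - 1) * (a \<bullet> a) + \<alpha>)"
    \<comment> \<open>The range \<open>e \<le> \<gamma>\<close> keeps the coefficient
      \<open>\<gamma> - e\<close> nonnegative, so its absolute value is linear in \<open>e\<close>
      and the penalty drops by exactly \<open>\<alpha> * e\<close>.\<close>
    proof (rule linear_coefficient_nonneg[OF \<open>\<gamma> > 0\<close>])
      fix e :: real assume "0 < e" "e \<le> \<gamma>"
      then show "0 \<le> e * - ((\<gamma> - 1) * (a \<bullet> a) + \<alpha>) + e\<^sup>2 * (1 / 2 * (a \<bullet> a))"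
        using le[of "\<gamma> - e" 0]
        by (simp add: power_mult_distrib dot_square_norm) (simp add: power2_eq_square field_simps)
    qed
    \<comment> \<open>Otherwise \<open>(\<gamma> - 1) * (a \<bullet> a) + \<alpha>\<close> would be
      positive.\<close>
    then have "\<gamma> < 1"
      using \<open>\<alpha> > 0\<close> mult_nonneg_nonneg[of "\<gamma> - 1" "a \<bullet> a"]
        inner_ge_zero[of a] by linarith
    \<comment> \<open>The two signs \<open>\<sigma>\<close> together give the bound on the absolute
      value.\<close>
    have "\<sigma> * (a \<bullet> b) \<le> a \<bullet> a" if "\<bar>\<sigma>\<bar> = 1" for \<sigma>
    proof -
      have "0 \<le> (\<gamma> - 1) * (a \<bullet> (\<sigma> *\<^sub>R b - a))"
      proof (rule linear_coefficient_nonneg[OF \<open>\<gamma> > 0\<close>])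
        fix e :: real assume e: "0 < e" "e \<le> \<gamma>"
        have "(\<gamma> - e - 1) *\<^sub>R a + (\<sigma> * e) *\<^sub>R b = (\<gamma> - 1) *\<^sub>R a + e *\<^sub>R (\<sigma> *\<^sub>R b - a)"
          by (simp add: algebra_simps)
        \<comment> \<open>Both penalties equal \<open>\<alpha> * \<gamma>\<close>, since
          \<open>(\<gamma> - e) + \<bar>\<sigma> * e\<bar> = \<gamma>\<close>, and cancel.\<close>
        then have "(norm ((\<gamma> - 1) *\<^sub>R a))\<^sup>2 \<le> (norm ((\<gamma> - 1) *\<^sub>R a + e *\<^sub>R (\<sigma> *\<^sub>R b - a)))\<^sup>2"
          using le[of "\<gamma> - e" "\<sigma> * e"] e that by (simp add: abs_mult)
        also have "\<dots> = (norm ((\<gamma> - 1) *\<^sub>R a))\<^sup>2 + 2 * (e * ((\<gamma> - 1) * (a \<bullet> (\<sigma> *\<^sub>R b - a))))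
            + e\<^sup>2 * (norm (\<sigma> *\<^sub>R b - a))\<^sup>2"
          by (simp only: power2_norm_eq_inner inner_add_left inner_add_right inner_scaleR_left
              inner_scaleR_right inner_commute[of "\<sigma> *\<^sub>R b - a" a])
            (simp add: power2_eq_square distrib_left mult.left_commute)
        finally show "0 \<le> e * ((\<gamma> - 1) * (a \<bullet> (\<sigma> *\<^sub>R b - a)))
            + e\<^sup>2 * (1 / 2 * (norm (\<sigma> *\<^sub>R b - a))\<^sup>2)"
          by simp
      qed
      with \<open>\<gamma> < 1\<close> show ?thesis
        by (simp add: zero_le_mult_iff inner_diff_right)
    qed
    from this[of 1] this[of "-1"] show ?thesis
      by (simp add: a_def b_def)
  qed simp
qed

end
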